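(* Let $G$ be a finite simple graph and let $v$ be a vertex around which $G$ is not complete. Let $G_1$ be the graph obtained from $G$ by taking away $v$ and all edges of which $v$ is an end, and let $G_2$ be the graph obtained from $G$ by adding all edges which connect two vertices in $N_G(v)$. Then, for each $i\in\{1,2\}$, the number of vertices of $G_i$ around which $G_i$ is not complete is strictly smaller than the number of vertices of $G$ around which $G$ is not complete.
   Context: A simple graph has no loops and no multiple edges. For a simple graph $H$, $d_H(x,y)$ denotes the graph distance in $H$ (the minimal length of a path joining $x$ and $y$, or $\infty$ if there is none). $N_H(u)=\{x\mid d_H(x,u)=1\}$ is the neighborhood of $u$ in $H$. $H$ is complete around $u$ if $d_H(x,y)\le 1$ for all $x,y\in N_H(u)$. *)

theory Defs
  imports "Graph_Theory.Graph_Theory"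
begin

text \<open>
  A finite simple graph is a \<^locale>\<open>pair_graph\<close>: a finite loop-free symmetric relation, the edge
  joining \<open>x\<close> and \<open>y\<close> being represented by the two arcs \<open>(x, y)\<close> and \<open>(y, x)\<close>. The notions below
  are stated for \<^type>\<open>pre_digraph\<close> structures, and agree with the undirected ones on symmetric
  graphs, where directed paths and undirected paths between two vertices coincide.
\<close>

text \<open>If no path joins the two vertices, the infimum is taken over the empty set and is \<open>\<infinity>\<close>.\<close>

definition graph_dist :: "('a, 'b) pre_digraph \<Rightarrow> 'a \<Rightarrow> 'a \<Rightarrow> enat" where
  "graph_dist H x y = (INF p \<in> {p. pre_digraph.apath H x p y}. enat (length p))"

definition neighborhood :: "('a, 'b) pre_digraph \<Rightarrow> 'a \<Rightarrow> 'a set" where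
  "neighborhood H u = {x. graph_dist H x u = 1}"

definition complete_around :: "('a, 'b) pre_digraph \<Rightarrow> 'a \<Rightarrow> bool" where
  "complete_around H u \<longleftrightarrow>
     (\<forall>x \<in> neighborhood H u. \<forall>y \<in> neighborhood H u. graph_dist H x y \<le> 1)"

definition noncomplete_verts :: "('a, 'b) pre_digraph \<Rightarrow> 'a set" where
  "noncomplete_verts H = {u \<in> verts H. \<not> complete_around H u}"

text \<open>The condition \<open>x \<noteq> y\<close> keeps the graph loop-free.\<close>

definition complete_neighborhood :: "'a pair_pre_digraph \<Rightarrow> 'a \<Rightarrow> 'a pair_pre_digraph" where
  "complete_neighborhood G v =
     \<lparr> pverts = pverts G,
       parcs = parcs G \<union> {(x, y). x \<in> neighborhood (with_proj G) v \<and>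
                                   y \<in> neighborhood (with_proj G) v \<and> x \<noteq> y} \<rparr>"

end

theory Submission
  imports Defs
begin

text \<open>Completeness around \<open>u\<close> only says that distinct neighbors of
  \<open>u\<close> are adjacent (\<open>complete_around_iff\<close>). Both constructions preserve it
  at every vertex (\<open>complete_around_del_vert\<close>,
  \<open>complete_around_complete_neighborhood\<close>), so no new noncomplete vertex arises.
  Meanwhile \<open>v\<close> leaves the set: it is deleted, or its neighborhood has become a clique.
  The inclusion of noncomplete sets is thus strict, and finiteness gives the inequality of
  cardinalities.\<close>

text \<open>These are exactly the conditions for an \<open>apath\<close> of length one from
  \<open>x\<close> to \<open>y\<close>, so the distance lemmas need no well-formedness of
  \<open>H\<close>.\<close>

definition adjacent :: "('a, 'b) pre_digraph \<Rightarrow> 'a \<Rightarrow> 'a \<Rightarrow> bool" where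
  "adjacent H x y \<longleftrightarrow> x \<in> verts H \<and> x \<noteq> y \<and> (\<exists>a \<in> arcs H. tail H a = x \<and> head H a = y)"

text \<open>A strict upper bound on an infimum yields a witnessing path directly; distance 0 and
  distance at most 1 are therefore read below as \<open>< 1\<close> and \<open>< 2\<close>.\<close>

lemma graph_dist_less_iff:
  "graph_dist H x y < n \<longleftrightarrow> (\<exists>p. pre_digraph.apath H x p y \<and> enat (length p) < n)"
  by (auto simp: graph_dist_def INF_less_iff)

lemma graph_dist_eq_0_iff: "graph_dist H x y = 0 \<longleftrightarrow> x \<in> verts H \<and> x = y"
proof -
  have "graph_dist H x y = 0 \<longleftrightarrow> graph_dist H x y < 1"
    by (simp add: iless_Suc_eq one_eSuc)
  also have "\<dots> \<longleftrightarrow> x \<in> verts H \<and> x = y"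
    unfolding graph_dist_less_iff
    by (auto simp: pre_digraph.apath_def pre_digraph.awalk_def pre_digraph.cas.simps
        pre_digraph.awalk_verts.simps one_enat_def)
  finally show ?thesis .
qed

lemma graph_dist_le_1_iff:
  "graph_dist H x y \<le> 1 \<longleftrightarrow> (x \<in> verts H \<and> x = y) \<or> adjacent H x y"
proof -
  have "graph_dist H x y \<le> 1 \<longleftrightarrow> graph_dist H x y < enat 2"
    by (cases "graph_dist H x y") (auto simp: one_enat_def)
  also have "\<dots> \<longleftrightarrow> (\<exists>p. pre_digraph.apath H x p y \<and> (p = [] \<or> (\<exists>a. p = [a])))"
    unfolding graph_dist_less_iff
    by (intro ex_cong1 conj_cong refl) (auto simp: less_Suc_eq numeral_2_eq_2 length_Suc_conv)
  also have "\<dots> \<longleftrightarrow> pre_digraph.apath H x [] y \<or> (\<exists>a. pre_digraph.apath H x [a] y)"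
    by blast
  also have "\<dots> \<longleftrightarrow> (x \<in> verts H \<and> x = y) \<or> adjacent H x y"
    by (auto simp: pre_digraph.apath_def pre_digraph.awalk_def pre_digraph.cas.simps
        pre_digraph.awalk_verts.simps adjacent_def)
  finally show ?thesis .
qed

lemma neighborhood_eq: "neighborhood H u = {x. adjacent H x u}"
proof -
  have "graph_dist H x u = 1 \<longleftrightarrow> graph_dist H x u \<le> 1 \<and> graph_dist H x u \<noteq> 0" for x
    by (cases "graph_dist H x u") (auto simp: one_enat_def zero_enat_def)
  then show ?thesis
    by (auto simp: neighborhood_def graph_dist_le_1_iff graph_dist_eq_0_iff adjacent_def)
qed

lemma complete_around_iff:
  "complete_around H u \<longleftrightarrow>
     (\<forall>x y. adjacent H x u \<longrightarrow> adjacent H y u \<longrightarrow> x \<noteq> y \<longrightarrow> adjacent H x y)"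
  by (auto simp: complete_around_def neighborhood_eq graph_dist_le_1_iff adjacent_def)

lemma adjacent_with_proj:
  assumes "pair_graph G"
  shows "adjacent (with_proj G) x y \<longleftrightarrow> (x, y) \<in> parcs G"
proof -
  interpret pair_graph G by fact
  show ?thesis
    by (force simp: adjacent_def dest: in_arcsD1 no_loops')
qed

lemma adjacent_del_vert:
  "adjacent (pre_digraph.del_vert H v) x y \<longleftrightarrow> adjacent H x y \<and> x \<noteq> v \<and> y \<noteq> v"
  by (auto simp: adjacent_def pre_digraph.del_vert_def)

lemma adjacent_complete_neighborhood:
  assumes "pair_graph G"
  shows "adjacent (with_proj (complete_neighborhood G v)) x y \<longleftrightarrow>
    (x, y) \<in> parcs G \<or> (x, v) \<in> parcs G \<and> (y, v) \<in> parcs G \<and> x \<noteq> y"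
proof -
  interpret pair_graph G by fact
  show ?thesis
    unfolding adjacent_def[of "with_proj (complete_neighborhood G v)"]
    by (force simp: complete_neighborhood_def neighborhood_eq
        adjacent_with_proj[OF assms] dest: in_arcsD1 no_loops')
qed

text \<open>Deletion passes to an induced subgraph: \<open>u\<close> gains no neighbors, and
  surviving vertices keep their adjacencies. For \<open>u = v\<close> no neighbors remain.\<close>

lemma complete_around_del_vert:
  "complete_around H u \<Longrightarrow> complete_around (pre_digraph.del_vert H v) u"
  by (auto simp: complete_around_iff adjacent_del_vert)

text \<open>Without loops \<open>v\<close> is not its own neighbor, so no added edge ends at
  \<open>v\<close>: its neighborhood is the old one, now a clique.\<close>

lemma complete_around_complete_neighborhood_self:
  assumes "pair_graph G"
  shows "complete_around (with_proj (complete_neighborhood G v)) v"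
proof -
  interpret pair_graph G by fact
  show ?thesis
    by (auto simp: complete_around_iff adjacent_complete_neighborhood[OF assms] dest: no_loops')
qed

lemma complete_around_complete_neighborhood:
  assumes "pair_graph G" and "complete_around (with_proj G) u"
  shows "complete_around (with_proj (complete_neighborhood G v)) u"
proof -
  interpret pair_graph G by fact
  have sym: "(x, y) \<in> parcs G \<longleftrightarrow> (y, x) \<in> parcs G" for x y
    using arcs_symmetric by blast
  have complete: "(x, y) \<in> parcs G" if "(x, u) \<in> parcs G" "(y, u) \<in> parcs G" "x \<noteq> y" for x y
    using assms(2) that by (auto simp: complete_around_iff adjacent_with_proj[OF assms(1)])
  show ?thesis
  proof (cases "(u, v) \<in> parcs G")
    case True
    \<comment> \<open>Here the closed neighborhood of \<open>u\<close> in \<open>G\<close> is contained in that of \<open>v\<close>, and the latter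
      becomes the closed neighborhood of \<open>u\<close> in the new graph.\<close>
    have "(x, u) \<in> parcs G \<Longrightarrow> x = v \<or> (x, v) \<in> parcs G" for x
      using complete True sym by blast
    then show ?thesis
      unfolding complete_around_iff adjacent_complete_neighborhood[OF assms(1)]
      using sym by blast
  next
    case False
    \<comment> \<open>Added edges have both ends adjacent to \<open>v\<close>, so none ends at
      \<open>u\<close>: its neighborhood is unchanged, and its neighbors lose no adjacency. This
      case includes \<open>u = v\<close>.\<close>
    then show ?thesis
      unfolding complete_around_iff adjacent_complete_neighborhood[OF assms(1)]
      using complete by blast
  qed
qed

text \<open>The counting argument shared by both constructions, with \<open>v\<close> witnessing
  that the inclusion is strict.\<close>

lemma card_noncomplete_verts_less:
  assumes "finite (verts G)" "v \<in> noncomplete_verts G" "v \<notin> noncomplete_verts H"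
    and "verts H \<subseteq> verts G"
    and "\<And>u. complete_around G u \<Longrightarrow> complete_around H u"
  shows "card (noncomplete_verts H) < card (noncomplete_verts G)"
proof (rule psubset_card_mono)
  show "finite (noncomplete_verts G)"
    using assms(1) by (simp add: noncomplete_verts_def)
  show "noncomplete_verts H \<subset> noncomplete_verts G"
    using assms(2-) by (auto simp: noncomplete_verts_def)
qed

theorem lemma4p9:
  fixes G :: "'a pair_pre_digraph" and v :: 'a
  assumes "pair_graph G"
    and "v \<in> pverts G"
    and "\<not> complete_around (with_proj G) v"
  shows "card (noncomplete_verts (pre_digraph.del_vert (with_proj G) v))
           < card (noncomplete_verts (with_proj G))
       \<and> card (noncomplete_verts (with_proj (complete_neighborhood G v)))
           < card (noncomplete_verts (with_proj G))"
proof -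
  interpret pair_graph G by fact
  have v: "v \<in> noncomplete_verts (with_proj G)"
    using assms(2,3) by (simp add: noncomplete_verts_def)
  show ?thesis
  proof
    show "card (noncomplete_verts (pre_digraph.del_vert (with_proj G) v))
      < card (noncomplete_verts (with_proj G))"
    proof (rule card_noncomplete_verts_less[OF _ v])
      show "v \<notin> noncomplete_verts (pre_digraph.del_vert (with_proj G) v)"
        by (simp add: noncomplete_verts_def pre_digraph.verts_del_vert)
    qed (auto simp: pre_digraph.verts_del_vert intro: complete_around_del_vert)
    show "card (noncomplete_verts (with_proj (complete_neighborhood G v)))
      < card (noncomplete_verts (with_proj G))"
    proof (rule card_noncomplete_verts_less[OF _ v])
      show "v \<notin> noncomplete_verts (with_proj (complete_neighborhood G v))"
        by (simp add: noncomplete_verts_def complete_around_complete_neighborhood_self[OF assms(1)])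
      show "verts (with_proj (complete_neighborhood G v)) \<subseteq> verts (with_proj G)"
        by (simp add: complete_neighborhood_def)
    qed (auto intro: complete_around_complete_neighborhood[OF assms(1)])
  qed
qed

end
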